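(* Let $N\ge 7$ be an odd integer. Then \[ \mathrm{Kf}(G_N^{(2)})=\frac{2N^2}{\sqrt{4N-25}}\,\Im(C_N)-1, \] where $\Im$ denotes the imaginary part and \[ C_N:=\frac{2+\mathcal P_N^{(2)}+d\,\mathcal B_N^{(2)}}{d\left(2-\mathcal P_N^{(2)}-d\,\mathcal B_N^{(2)}\right)}. \]
   Context: For odd $N$, the graph $G_N^{(2)}$ has vertex set $\mathbb Z/N\mathbb Z$; two distinct vertices $x,y$ are adjacent iff their circular distance $\min\{|x-y|,N-|x-y|\}$ (with representatives in $\{0,\dots,N-1\}$) is at least $3$. For a connected graph with Laplacian matrix $L$ (degree matrix minus adjacency matrix) and Moore--Penrose pseudoinverse $L^+$, the effective resistance is $R(x,y)=(e_x-e_y)^*L^+(e_x-e_y)$. The Kirchhoff index of a graph $G=(V,E)$ is $\mathrm{Kf}(G)=\frac12\sum_{x,y\in V}R(x,y)$, the sum being over ordered pairs. Set $\tau:=\frac{-1+i\sqrt{4N-25}}{2}$, let $\rho\in\mathbb C$ be the solution of $\rho+\rho^{-1}=\tau$ with $|\rho|<1$, and let $d:=\rho-\rho^{-1}$. For $k\ge0$, $\mathcal P_k^{(2)}:=\rho^k+\rho^{-k}$ and $\mathcal B_k^{(2)}:=\frac{\rho^k-\rho^{-k}}{d}$. *)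

theory Defs
  imports Complex_Main "Jordan_Normal_Form.Matrix"
begin

text \<open>A simple graph on the vertex set \<open>{0..<n}\<close> is given by \<open>n\<close> and an
  adjacency relation \<open>E\<close>, symmetric and irreflexive on \<open>{0..<n}\<close>.\<close>

definition adjacency_mat :: "nat \<Rightarrow> (nat \<Rightarrow> nat \<Rightarrow> bool) \<Rightarrow> real mat" where
  "adjacency_mat n E = mat n n (\<lambda>(x, y). if E x y then 1 else 0)"

definition degree_mat :: "nat \<Rightarrow> (nat \<Rightarrow> nat \<Rightarrow> bool) \<Rightarrow> real mat" where
  "degree_mat n E =
     mat n n (\<lambda>(x, y). if x = y then real (card {z \<in> {0..<n}. E x z}) else 0)"

definition laplacian_mat :: "nat \<Rightarrow> (nat \<Rightarrow> nat \<Rightarrow> bool) \<Rightarrow> real mat" where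
  "laplacian_mat n E = degree_mat n E - adjacency_mat n E"

text \<open>The four Penrose conditions; over the reals the adjoint is the transpose. They determine
  \<open>X\<close> uniquely.\<close>

definition is_pseudoinverse :: "real mat \<Rightarrow> real mat \<Rightarrow> bool" where
  "is_pseudoinverse A X \<longleftrightarrow>
     X \<in> carrier_mat (dim_col A) (dim_row A) \<and>
     A * X * A = A \<and>
     X * A * X = X \<and>
     transpose_mat (A * X) = A * X \<and>
     transpose_mat (X * A) = X * A"

definition pseudoinverse :: "real mat \<Rightarrow> real mat" where
  "pseudoinverse A = (THE X. is_pseudoinverse A X)"

definition effective_resistance :: "nat \<Rightarrow> (nat \<Rightarrow> nat \<Rightarrow> bool) \<Rightarrow> nat \<Rightarrow> nat \<Rightarrow> real" where
  "effective_resistance n E x y =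
     (unit_vec n x - unit_vec n y) \<bullet>
       (pseudoinverse (laplacian_mat n E) *\<^sub>v (unit_vec n x - unit_vec n y))"

definition kirchhoff_index :: "nat \<Rightarrow> (nat \<Rightarrow> nat \<Rightarrow> bool) \<Rightarrow> real" where
  "kirchhoff_index n E =
     1 / 2 * (\<Sum>x\<in>{0..<n}. \<Sum>y\<in>{0..<n}. effective_resistance n E x y)"

text \<open>Residue classes modulo \<open>N\<close> are represented by \<open>{0..<N}\<close>.\<close>

definition circular_distance :: "nat \<Rightarrow> nat \<Rightarrow> nat \<Rightarrow> int" where
  "circular_distance N x y = min \<bar>int x - int y\<bar> (int N - \<bar>int x - int y\<bar>)"

definition G2_adj :: "nat \<Rightarrow> nat \<Rightarrow> nat \<Rightarrow> bool" where
  "G2_adj N x y \<longleftrightarrow>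
     x \<in> {0..<N} \<and> y \<in> {0..<N} \<and> x \<noteq> y \<and> circular_distance N x y \<ge> 3"

definition tau2 :: "nat \<Rightarrow> complex" where
  "tau2 N = (- 1 + \<i> * complex_of_real (sqrt (4 * real N - 25))) / 2"

text \<open>For \<open>N \<ge> 7\<close> the number \<open>tau2 N\<close> is not real. The two roots of \<open>r\<^sup>2 - tau2 N * r + 1\<close> then
  have product \<open>1\<close> and do not lie on the unit circle, so exactly one of them lies inside it.\<close>

definition rho2 :: "nat \<Rightarrow> complex" where
  "rho2 N = (THE r. r \<noteq> 0 \<and> r + inverse r = tau2 N \<and> cmod r < 1)"

definition d2 :: "nat \<Rightarrow> complex" where
  "d2 N = rho2 N - inverse (rho2 N)"

definition P2 :: "nat \<Rightarrow> nat \<Rightarrow> complex" where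
  "P2 N k = rho2 N ^ k + inverse (rho2 N) ^ k"

definition B2 :: "nat \<Rightarrow> nat \<Rightarrow> complex" where
  "B2 N k = (rho2 N ^ k - inverse (rho2 N) ^ k) / d2 N"

definition C2 :: "nat \<Rightarrow> complex" where
  "C2 N = (2 + P2 N N + d2 N * B2 N N) / (d2 N * (2 - P2 N N - d2 N * B2 N N))"

end

theory Submission
  imports Defs
begin

text \<open>Adding the all-ones matrix \<open>J\<close> to the Laplacian gives an invertible matrix \<open>M\<close> with
  \<open>tr M\<inverse> = tr L\<^sup>+ + 1 / N\<close>, so that \<open>Kf = N tr M\<inverse> - 1\<close>. Here \<open>M\<close> is the circulant
  \<open>S\<^sup>2 + S + (N - 4) + S\<inverse> + S\<inverse>\<^sup>2 = (A - \<tau>)(A - cnj \<tau>)\<close> with \<open>S\<close> the cyclic shift and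
  \<open>A = S + S\<inverse>\<close>. The resolvent \<open>(A - \<tau>)\<inverse>\<close> is the circulant with entries
  \<open>h k = (\<rho>\<^sup>k + \<rho>\<^sup>N\<^sup>-\<^sup>k) / (d (1 - \<rho>\<^sup>N))\<close>, and partial fractions give
  \<open>M\<inverse> = Im (A - \<tau>)\<inverse> / Im \<tau>\<close>. Finally \<open>h 0 = C\<^sub>N\<close>, since \<open>\<P>\<^sub>N + d \<B>\<^sub>N = 2 \<rho>\<^sup>N\<close>.\<close>

section \<open>Pseudoinverse and Kirchhoff index\<close>

text \<open>Penrose's argument: \<open>A * X\<close> and \<open>A * Y\<close> are symmetric and each
  absorbs the other, so transposing their product gives \<open>A * X = A * Y\<close>; likewise
  \<open>X * A = Y * A\<close>. Then
  \<open>X = X * A * X = X * A * Y = Y * A * Y = Y\<close>.\<close>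

lemma is_pseudoinverse_unique:
  assumes "is_pseudoinverse A X" "is_pseudoinverse A Y"
  shows "X = Y"
proof -
  define n m where "n = dim_row A" and "m = dim_col A"
  have A[simp]: "A \<in> carrier_mat n m" by (auto simp: n_def m_def)
  have X[simp]: "X \<in> carrier_mat m n" and Y[simp]: "Y \<in> carrier_mat m n"
    using assms by (auto simp: is_pseudoinverse_def n_def m_def)
  have x: "A * X * A = A" "X * A * X = X" "transpose_mat (A * X) = A * X"
      "transpose_mat (X * A) = X * A"
    and y: "A * Y * A = A" "Y * A * Y = Y" "transpose_mat (A * Y) = A * Y"
      "transpose_mat (Y * A) = Y * A"
    using assms by (auto simp: is_pseudoinverse_def)
  have AX[simp]: "A * X \<in> carrier_mat n n" and AY[simp]: "A * Y \<in> carrier_mat n n"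
    and XA[simp]: "X * A \<in> carrier_mat m m" and YA[simp]: "Y * A \<in> carrier_mat m m"
    by (auto intro: mult_carrier_mat[OF A X] mult_carrier_mat[OF A Y]
        mult_carrier_mat[OF X A] mult_carrier_mat[OF Y A])
  have "A * X = (A * Y) * (A * X)"
    using y(1) assoc_mult_mat[OF AY A X] by simp
  then have "A * X = transpose_mat ((A * Y) * (A * X))"
    using x(3) by simp
  also have "\<dots> = (A * X) * (A * Y)"
    using transpose_mult[OF AY AX] x(3) y(3) by simp
  also have "\<dots> = A * Y"
    using x(1) assoc_mult_mat[OF AX A Y] by simp
  finally have 1: "A * X = A * Y" .
  have "X * A = (X * A) * (Y * A)"
    using y(1) assoc_mult_mat[OF X A YA] assoc_mult_mat[OF A Y A] by simp
  then have "X * A = transpose_mat ((X * A) * (Y * A))"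
    using x(4) by simp
  also have "\<dots> = (Y * A) * (X * A)"
    using transpose_mult[OF XA YA] x(4) y(4) by simp
  also have "\<dots> = Y * A"
    using x(1) assoc_mult_mat[OF Y A XA] assoc_mult_mat[OF A X A] by simp
  finally have 2: "X * A = Y * A" .
  have "X = X * (A * X)" using x(2) assoc_mult_mat[OF X A X] by simp
  also have "\<dots> = X * A * Y" using 1 assoc_mult_mat[OF X A Y] by simp
  also have "\<dots> = Y" using 2 y(2) by simp
  finally show ?thesis .
qed

lemma pseudoinverse_eqI: "is_pseudoinverse A X \<Longrightarrow> pseudoinverse A = X"
  unfolding pseudoinverse_def using is_pseudoinverse_unique by blast

lemma quadratic_form_unit_vec_diff:
  fixes X :: "'a::comm_ring_1 mat"
  assumes X: "X \<in> carrier_mat n n" and x: "x < n" and y: "y < n"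
  shows "(unit_vec n x - unit_vec n y) \<bullet> (X *\<^sub>v (unit_vec n x - unit_vec n y)) =
    X $$ (x, x) - X $$ (x, y) - X $$ (y, x) + X $$ (y, y)"
proof -
  have 1: "X *\<^sub>v (unit_vec n x - unit_vec n y) = col X x - col X y" (is "_ = ?w")
    using assms
    by (intro eq_vecI) (auto simp: scalar_prod_minus_distrib[where n = n])
  have w: "?w \<in> carrier_vec n" using X by auto
  have "(unit_vec n x - unit_vec n y) \<bullet> ?w = ?w $ x - ?w $ y"
    using minus_scalar_prod_distrib[OF _ _ w, of "unit_vec n x" "unit_vec n y"] w x y by simp
  then show ?thesis
    using assms by (simp add: 1)
qed

text \<open>The two mixed double sums agree after exchanging the order of summation, and each
  diagonal entry is counted \<open>2 * n\<close> times.\<close>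

lemma kirchhoff_index_eq_pseudoinverse:
  assumes X: "X \<in> carrier_mat n n" and P: "pseudoinverse (laplacian_mat n E) = X"
  shows "kirchhoff_index n E =
    real n * (\<Sum>x\<in>{0..<n}. X $$ (x, x)) - (\<Sum>x\<in>{0..<n}. \<Sum>y\<in>{0..<n}. X $$ (x, y))"
proof -
  have "(\<Sum>x\<in>{0..<n}. \<Sum>y\<in>{0..<n}. effective_resistance n E x y) =
    (\<Sum>x\<in>{0..<n}. \<Sum>y\<in>{0..<n}. X $$ (x, x) - X $$ (x, y) - X $$ (y, x) + X $$ (y, y))"
    unfolding effective_resistance_def P
    by (intro sum.cong refl quadratic_form_unit_vec_diff[OF X]) auto
  also have "\<dots> = 2 * (real n * (\<Sum>x\<in>{0..<n}. X $$ (x, x))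
      - (\<Sum>x\<in>{0..<n}. \<Sum>y\<in>{0..<n}. X $$ (x, y)))"
    using sum.swap[of "\<lambda>x y. X $$ (y, x)" "{0..<n}" "{0..<n}"]
    by (simp add: sum.distrib sum_subtractf flip: sum_distrib_left)
  finally show ?thesis
    by (simp add: kirchhoff_index_def)
qed

section \<open>The Laplacian and the all-ones matrix\<close>

lemma transpose_smult_mat: "transpose_mat (c \<cdot>\<^sub>m A) = c \<cdot>\<^sub>m transpose_mat A"
  by (intro eq_matI) auto

definition ones_mat :: "nat \<Rightarrow> real mat" where
  "ones_mat n = mat n n (\<lambda>_. 1)"

lemma ones_mat_carrier [simp]: "ones_mat n \<in> carrier_mat n n"
  by (simp add: ones_mat_def)

lemma transpose_ones_mat [simp]: "transpose_mat (ones_mat n) = ones_mat n"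
  by (auto simp: ones_mat_def)

lemma ones_mat_square: "ones_mat n * ones_mat n = real n \<cdot>\<^sub>m ones_mat n"
  by (intro eq_matI) (auto simp: ones_mat_def scalar_prod_def)

lemma laplacian_mat_carrier [simp]: "laplacian_mat n E \<in> carrier_mat n n"
  unfolding laplacian_mat_def by (rule minus_carrier_mat) (simp add: adjacency_mat_def)

lemma transpose_laplacian_mat:
  assumes "\<And>x y. x < n \<Longrightarrow> y < n \<Longrightarrow> E x y \<longleftrightarrow> E y x"
  shows "transpose_mat (laplacian_mat n E) = laplacian_mat n E"
  using assms
  by (intro eq_matI) (auto simp: laplacian_mat_def adjacency_mat_def degree_mat_def)

lemma laplacian_mat_mult_ones_mat: "laplacian_mat n E * ones_mat n = 0\<^sub>m n n"
proof (intro eq_matI, goal_cases)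
  case (1 i j)
  have "(\<Sum>k\<in>{0..<n}. if E i k then 1 else 0 :: real) = real (card {z \<in> {0..<n}. E i z})"
    by (simp add: sum.If_cases Int_def)
  with 1 show ?case
    by (simp add: laplacian_mat_def adjacency_mat_def degree_mat_def ones_mat_def scalar_prod_def
        sum_subtractf)
qed (simp_all add: laplacian_mat_def adjacency_mat_def ones_mat_def)

text \<open>\<open>L\<close> and \<open>J\<close> annihilate each other, so the inverse of
  \<open>L + J\<close> is the pseudoinverse of \<open>L\<close> plus that of \<open>J\<close>, which
  is \<open>J / r^2\<close>. Subtracting the latter lowers the trace by \<open>1 / r\<close> and
  leaves a matrix whose entries sum to zero.\<close>

lemma kirchhoff_index_eq_trace_inverse:
  assumes n: "n > 0"
    and E: "\<And>x y. x < n \<Longrightarrow> y < n \<Longrightarrow> E x y \<longleftrightarrow> E y x"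
    and G: "G \<in> carrier_mat n n" "transpose_mat G = G"
    and inv: "(laplacian_mat n E + ones_mat n) * G = 1\<^sub>m n"
  shows "kirchhoff_index n E = real n * (\<Sum>x\<in>{0..<n}. G $$ (x, x)) - 1"
proof -
  define L J where "L = laplacian_mat n E" and "J = ones_mat n"
  define r where "r = real n"
  have r: "r \<noteq> 0" using n by (simp add: r_def)
  define X where "X = G - (1 / r^2) \<cdot>\<^sub>m J"
  define P where "P = 1\<^sub>m n - (1 / r) \<cdot>\<^sub>m J"
  have c[simp]: "L \<in> carrier_mat n n" "J \<in> carrier_mat n n" "G \<in> carrier_mat n n"
    "L + J \<in> carrier_mat n n" "X \<in> carrier_mat n n" "P \<in> carrier_mat n n"
    using G by (auto simp: L_def J_def X_def P_def intro!: minus_carrier_mat)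
  have sym[simp]: "transpose_mat L = L" "transpose_mat J = J"
    using transpose_laplacian_mat[of n E] E by (auto simp: L_def J_def)
  have X_sym: "transpose_mat X = X"
    using G(2) sym(2) by (simp add: X_def transpose_minus[of _ n n] transpose_smult_mat)
  have P_sym: "transpose_mat P = P"
    using sym(2) by (simp add: P_def transpose_minus[of _ n n] transpose_smult_mat)
  have LJ: "L * J = 0\<^sub>m n n"
    by (simp add: L_def J_def laplacian_mat_mult_ones_mat)
  have JL: "J * L = 0\<^sub>m n n"
    using arg_cong[OF LJ, of transpose_mat] transpose_mult[OF c(1,2)] by simp
  have JJ: "J * J = r \<cdot>\<^sub>m J" by (simp add: J_def r_def ones_mat_square)
  have inv': "(L + J) * G = 1\<^sub>m n" using inv by (simp add: L_def J_def)
  \<comment> \<open>Multiplying the inverse equation by \<open>J\<close> on the left removes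
    \<open>L\<close> and isolates \<open>J * G\<close>.\<close>
  have "J = J * ((L + J) * G)" using inv' right_mult_one_mat[OF c(2)] by simp
  also have "\<dots> = (J * (L + J)) * G" using assoc_mult_mat[of J n n "L + J" n G n] by simp
  also have "J * (L + J) = r \<cdot>\<^sub>m J"
    by (simp add: mult_add_distrib_mat[of J n n L n J] JL JJ)
  also have "r \<cdot>\<^sub>m J * G = r \<cdot>\<^sub>m (J * G)" by (rule mult_smult_assoc_mat[of _ n n _ n]) auto
  finally have "(1 / r) \<cdot>\<^sub>m J = (1 / r) \<cdot>\<^sub>m (r \<cdot>\<^sub>m (J * G))" by simp
  also have "\<dots> = J * G" using r by (intro eq_matI) auto
  finally have JG: "J * G = (1 / r) \<cdot>\<^sub>m J" by simp
  have "L * G = (L * G + J * G) - J * G"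
    using carrier_matD[OF c(1)] carrier_matD[OF c(2)] carrier_matD[OF c(3)]
    by (intro eq_matI) auto
  also have "L * G + J * G = 1\<^sub>m n"
    using inv' add_mult_distrib_mat[of L n n J G n] by simp
  finally have LG: "L * G = P" by (simp add: P_def JG)
  have LX: "L * X = P"
  proof -
    have "L * X = L * G - L * ((1 / r^2) \<cdot>\<^sub>m J)"
      unfolding X_def by (rule mult_minus_distrib_mat[of _ n n _ n]) auto
    also have "L * ((1 / r^2) \<cdot>\<^sub>m J) = (1 / r^2) \<cdot>\<^sub>m (L * J)"
      by (rule mult_smult_distrib[of _ n n _ n]) auto
    also have "\<dots> = 0\<^sub>m n n" by (simp add: LJ)
    also have "L * G - 0\<^sub>m n n = P"
      unfolding LG using carrier_matD[OF c(6)] by (intro eq_matI) auto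
    finally show ?thesis .
  qed
  have XL: "X * L = P"
    using arg_cong[OF LX, of transpose_mat] transpose_mult[of L n n X n] X_sym P_sym by simp
  have JX: "J * X = 0\<^sub>m n n"
  proof -
    have "J * X = J * G - J * ((1 / r^2) \<cdot>\<^sub>m J)"
      unfolding X_def by (rule mult_minus_distrib_mat[of _ n n _ n]) auto
    also have "J * ((1 / r^2) \<cdot>\<^sub>m J) = (1 / r^2) \<cdot>\<^sub>m (J * J)"
      by (rule mult_smult_distrib[of _ n n _ n]) auto
    also have "\<dots> = (1 / r) \<cdot>\<^sub>m J"
      unfolding JJ using r by (intro eq_matI) (auto simp: power2_eq_square)
    also have "J * G - (1 / r) \<cdot>\<^sub>m J = 0\<^sub>m n n"
      unfolding JG using carrier_matD[OF c(2)] by (intro eq_matI) auto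
    finally show ?thesis .
  qed
  have P_mult: "P * M = M" if "M \<in> carrier_mat n n" "J * M = 0\<^sub>m n n" for M
  proof -
    have "P * M = 1\<^sub>m n * M - (1 / r) \<cdot>\<^sub>m J * M"
      unfolding P_def by (rule minus_mult_distrib_mat[of _ n n _ _ n]) (use that in auto)
    also have "(1 / r) \<cdot>\<^sub>m J * M = (1 / r) \<cdot>\<^sub>m (J * M)"
      by (rule mult_smult_assoc_mat[of _ n n _ n]) (use that in auto)
    also have "1\<^sub>m n * M - \<dots> = M" using that by (intro eq_matI) auto
    finally show ?thesis .
  qed
  \<comment> \<open>\<open>L * X\<close> and \<open>X * L\<close> both equal the projection
    \<open>P\<close> that kills constants, and \<open>P\<close> fixes \<open>L\<close> and
    \<open>X\<close> because \<open>J\<close> annihilates both.\<close>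
  have "is_pseudoinverse L X"
    using P_mult[of L] P_mult[of X] JL JX LX XL P_sym c
    by (simp add: is_pseudoinverse_def carrier_matD[OF c(1)])
  then have "kirchhoff_index n E =
    real n * (\<Sum>x\<in>{0..<n}. X $$ (x, x)) - (\<Sum>x\<in>{0..<n}. \<Sum>y\<in>{0..<n}. X $$ (x, y))"
    by (intro kirchhoff_index_eq_pseudoinverse) (auto dest: pseudoinverse_eqI simp: L_def)
  \<comment> \<open>After the swap the inner sums are the column sums of \<open>X\<close>, which
    form row 0 of \<open>J * X = 0\<close>.\<close>
  also have "(\<Sum>x\<in>{0..<n}. \<Sum>y\<in>{0..<n}. X $$ (x, y)) = (\<Sum>y\<in>{0..<n}. \<Sum>x\<in>{0..<n}. X $$ (x, y))"
    by (rule sum.swap)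
  also have "\<dots> = (\<Sum>y\<in>{0..<n}. (J * X) $$ (0, y))"
    using n carrier_matD[OF c(5)]
    by (intro sum.cong) (auto simp: J_def ones_mat_def scalar_prod_def)
  also have "\<dots> = 0" using n by (simp add: JX)
  also have "(\<Sum>x\<in>{0..<n}. X $$ (x, x)) = (\<Sum>x\<in>{0..<n}. G $$ (x, x)) - 1 / r"
    using r carrier_matD[OF c(3)]
    by (simp add: X_def J_def ones_mat_def sum_subtractf r_def power2_eq_square)
  finally show ?thesis using r by (simp add: r_def algebra_simps)
qed

section \<open>The graph as a circulant\<close>

text \<open>The delta function of Z/N, lifted to a periodic function on the integers so that
  differences of vertices may be negative.\<close>

definition shift_ind :: "nat \<Rightarrow> int \<Rightarrow> real" where
  "shift_ind N k = (if int N dvd k then 1 else 0)"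

text \<open>Convolution with a shifted delta: exactly one \<open>z\<close> in the range is congruent
  to \<open>a\<close>, and periodicity replaces it by \<open>a\<close>.\<close>

lemma sum_shift_ind:
  assumes N: "N > 0" and f: "\<And>k. f (k + int N) = f k"
  shows "(\<Sum>z\<in>{0..<N}. shift_ind N (int z - a) * f (int z - b)) = f (a - b)"
proof -
  have per: "f (k + int N * m) = f k" for k m
  proof (induction m rule: int_induct[of _ 0])
    case (step1 i)
    then show ?case using f[of "k + int N * i"] by (simp add: algebra_simps)
  next
    case (step2 i)
    then show ?case using f[of "k + int N * (i - 1)"] by (simp add: algebra_simps)
  qed simp
  define c where "c = nat (a mod int N)"
  have c: "int c = a mod int N" "c < N" using N by (auto simp: c_def nat_less_iff)
  have eq: "int N dvd int z - a \<longleftrightarrow> z = c" if "z < N" for z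
    using that N c(1) by (auto simp flip: mod_eq_dvd_iff)
  have "(\<Sum>z\<in>{0..<N}. shift_ind N (int z - a) * f (int z - b)) =
      (\<Sum>z\<in>{0..<N}. if z = c then f (int z - b) else 0)"
    by (intro sum.cong) (auto simp: shift_ind_def eq)
  also have "\<dots> = f (int c - b)" using c(2) by simp
  also have "\<dots> = f (a - b)"
    using per[of "int c - b" "a div int N"] c(1) by (simp add: algebra_simps)
  finally show ?thesis .
qed

text \<open>Equal or non-adjacent vertices differ by a residue of \<open>{-2..2}\<close>. These five
  residues are distinct for \<open>N \<ge> 7\<close>, so at most one summand is 1.\<close>

lemma G2_adj_shift_ind:
  assumes N: "N \<ge> 7" and x: "x < N" and z: "z < N"
  shows "(if G2_adj N x z then 1 else 0) =
    1 - (\<Sum>e\<in>{-2..2}. shift_ind N (int z - (int x + e)))"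
proof -
  \<comment> \<open>The arguments that occur have absolute value at most \<open>N + 1\<close>, so
    only the multiples 0 and plus or minus \<open>N\<close> can arise.\<close>
  have dvd: "int N dvd k \<longleftrightarrow> k = 0 \<or> k = int N \<or> k = - int N" if "\<bar>k\<bar> < 2 * int N" for k
  proof
    assume "int N dvd k"
    then obtain m where m: "k = int N * m" by blast
    with that have "int N * \<bar>m\<bar> < int N * 2" by (simp add: abs_mult)
    then have "\<bar>m\<bar> < 2" using N by simp
    then have "m = 0 \<or> m = 1 \<or> m = -1" by arith
    with m show "k = 0 \<or> k = int N \<or> k = - int N" by auto
  qed auto
  have "(\<Sum>e\<in>{-2..2}. shift_ind N (int z - (int x + e))) =
      (\<Sum>e\<in>{-2..2}. if int z = int x + e \<or> int z = int x + e + int N \<or> int z = int x + e - int N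
        then 1 else 0)"
    using x z N by (intro sum.cong refl) (auto simp: shift_ind_def dvd)
  moreover have "{-2..2} = {-2, -1, 0, 1, 2::int}" by auto
  ultimately show ?thesis
    using x z N by (simp add: G2_adj_def circular_distance_def) (auto split: if_splits)
qed

text \<open>The all-ones matrix minus the adjacency matrix is a sum of five shifts, and every degree
  is \<open>N - 5\<close>.\<close>

lemma laplacian_G2_mult_circulant:
  assumes N: "N \<ge> 7" and f: "\<And>k. f (k + int N) = f k" and x: "x < N" and y: "y < N"
  shows "((laplacian_mat N (G2_adj N) + ones_mat N) * mat N N (\<lambda>(z, y). f (int z - int y))) $$ (x, y)
    = real (N - 5) * f (int x - int y) + (\<Sum>e\<in>{-2..2}. f (int x - int y + e))"
proof -
  have N0: "N > 0" using N by simp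
  \<comment> \<open>Used twice: the constant function 1 yields the degree, and \<open>f\<close>
    yields the five-term band.\<close>
  have sum_f: "(\<Sum>z\<in>{0..<N}. (\<Sum>e\<in>{-2..2}. shift_ind N (int z - (int x + e))) * g (int z - int y)) =
      (\<Sum>e\<in>{-2..2}. g (int x - int y + e))" if "\<And>k. g (k + int N) = g k" for g
    unfolding sum_distrib_right
    by (subst sum.swap) (simp add: sum_shift_ind[of N g, OF N0 that] diff_add_eq)
  have "real (card {z \<in> {0..<N}. G2_adj N x z}) = (\<Sum>z\<in>{0..<N}. if G2_adj N x z then 1 else 0)"
    by (simp add: sum.If_cases Int_def)
  also have "\<dots> = (\<Sum>z\<in>{0..<N}. 1 - (\<Sum>e\<in>{-2..2}. shift_ind N (int z - (int x + e))))"
    using N x by (intro sum.cong refl G2_adj_shift_ind) auto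
  also have "\<dots> = real (N - 5)"
    using sum_f[of "\<lambda>_. 1"] N by (simp add: sum_subtractf)
  finally have deg: "real (card {z \<in> {0..<N}. G2_adj N x z}) = real (N - 5)" .
  have "((laplacian_mat N (G2_adj N) + ones_mat N) * mat N N (\<lambda>(z, y). f (int z - int y))) $$ (x, y)
     = (\<Sum>z\<in>{0..<N}. ((if x = z then real (N - 5) else 0) + (1 - (if G2_adj N x z then 1 else 0)))
         * f (int z - int y))"
    using x y deg
    by (auto simp: laplacian_mat_def adjacency_mat_def degree_mat_def ones_mat_def scalar_prod_def
        intro!: sum.cong)
  also have "\<dots> = (\<Sum>z\<in>{0..<N}. (if x = z then real (N - 5) * f (int z - int y) else 0)
      + (\<Sum>e\<in>{-2..2}. shift_ind N (int z - (int x + e))) * f (int z - int y))"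
    using N x by (intro sum.cong refl) (subst G2_adj_shift_ind, auto simp: algebra_simps)
  also have "\<dots> = real (N - 5) * f (int x - int y) + (\<Sum>e\<in>{-2..2}. f (int x - int y + e))"
    using x sum_f[of f, OF f] by (simp add: sum.distrib)
  finally show ?thesis .
qed

section \<open>The resolvent of the cycle\<close>

lemma complex_joukowski_unique:
  fixes r q :: complex
  assumes "r \<noteq> 0" "q \<noteq> 0" "r + inverse r = q + inverse q" "cmod r < 1" "cmod q < 1"
  shows "r = q"
proof -
  have "(r - q) * (r * q - 1) = 0" using assms(1-3) by (simp add: field_simps)
  moreover have "cmod (r * q) < 1"
    using mult_strict_mono[OF assms(4,5)] by (simp add: norm_mult)
  then have "r * q \<noteq> 1" by auto
  ultimately show ?thesis by simp
qed

text \<open>The roots of \<open>r^2 - t * r + 1\<close> are mutually inverse. On the unit circle the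
  inverse is the conjugate, which would make \<open>t\<close> real; hence one root lies strictly
  inside.\<close>

lemma complex_joukowski_exists:
  fixes t :: complex
  assumes "Im t \<noteq> 0"
  obtains r where "r \<noteq> 0" "r + inverse r = t" "cmod r < 1"
proof -
  define r where "r = (t + csqrt (t\<^sup>2 - 4)) / 2"
  have "(csqrt (t\<^sup>2 - 4))\<^sup>2 = t\<^sup>2 - 4" by simp
  then have r2: "r * (t - r) = 1"
    by (simp add: r_def field_simps power2_eq_square)
  then have r0: "r \<noteq> 0" by auto
  then have r: "r + inverse r = t" using r2 by (simp add: field_simps)
  have "cmod r \<noteq> 1"
  proof
    assume "cmod r = 1"
    then have "r * cnj r = 1" by (simp add: complex_norm_square[symmetric])
    then have "inverse r = cnj r" by (rule inverse_unique)
    with r assms show False by auto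
  qed
  then consider "cmod r < 1" | "cmod (inverse r) < 1"
    using r0 by (fastforce simp: norm_inverse inverse_less_1_iff)
  then show thesis
  proof cases
    case 1
    with r0 r that show thesis by blast
  next
    case 2
    with r0 r that[of "inverse r"] show thesis by (simp add: add.commute)
  qed
qed

lemma rho2_properties:
  assumes "N \<ge> 7"
  shows "rho2 N \<noteq> 0" "rho2 N + inverse (rho2 N) = tau2 N" "cmod (rho2 N) < 1"
proof -
  have "Im (tau2 N) \<noteq> 0" using assms by (simp add: tau2_def)
  then obtain r where r: "r \<noteq> 0" "r + inverse r = tau2 N" "cmod r < 1"
    by (rule complex_joukowski_exists)
  have "\<exists>!r. r \<noteq> 0 \<and> r + inverse r = tau2 N \<and> cmod r < 1"
    using r by (intro ex1I[of _ r]) (auto intro: complex_joukowski_unique)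
  from theI'[OF this] show "rho2 N \<noteq> 0" "rho2 N + inverse (rho2 N) = tau2 N" "cmod (rho2 N) < 1"
    unfolding rho2_def by auto
qed

text \<open>Since \<open>S^2 + S^(-2) = A^2 - 2\<close>, the matrix \<open>M\<close> is
  \<open>A^2 + A + (N - 6)\<close>; \<open>tau2 N\<close> is a root of this polynomial.\<close>

lemma tau2_quadratic: "N \<ge> 7 \<Longrightarrow> (tau2 N)\<^sup>2 + tau2 N + of_nat N - 6 = 0"
  by (auto simp: tau2_def complex_eq_iff power2_eq_square field_simps)

section \<open>Green function of the cycle\<close>

text \<open>For \<open>cmod r < 1\<close> and \<open>N > 0\<close> this is the Green function
  \<open>r^|j| / (r - inverse r)\<close> of the integer line, summed over all \<open>j\<close>
  congruent to \<open>k\<close> modulo \<open>N\<close> as two geometric series.\<close>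

definition cycle_resolvent :: "nat \<Rightarrow> complex \<Rightarrow> int \<Rightarrow> complex" where
  "cycle_resolvent N r k =
    (r ^ nat (k mod int N) + r ^ (N - nat (k mod int N))) / ((r - inverse r) * (1 - r ^ N))"

lemma cycle_resolvent_periodic: "cycle_resolvent N r (k + int N) = cycle_resolvent N r k"
  by (simp add: cycle_resolvent_def)

lemma cycle_resolvent_uminus:
  assumes "N > 0"
  shows "cycle_resolvent N r (- k) = cycle_resolvent N r k"
proof (cases "k mod int N = 0")
  case True
  then have "(- k) mod int N = 0" by (simp add: zmod_zminus1_eq_if)
  with True show ?thesis by (simp add: cycle_resolvent_def)
next
  case False
  define m where "m = nat (k mod int N)"
  have m: "k mod int N = int m" "m < N" using assms by (auto simp: m_def nat_less_iff)
  have "nat ((- k) mod int N) = N - m" using False m by (simp add: zmod_zminus1_eq_if)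
  with m show ?thesis by (simp add: cycle_resolvent_def)
qed

text \<open>Within a period, \<open>r^m\<close> and \<open>r^(N - m)\<close> both solve the
  homogeneous recurrence; only the wrap-around at residue 0 leaves a defect, namely
  \<open>D\<close>.\<close>

lemma cycle_resolvent_eq:
  fixes r :: complex
  assumes N: "N \<ge> 2" and r: "r \<noteq> 0" "cmod r < 1"
  shows "cycle_resolvent N r (k + 1) + cycle_resolvent N r (k - 1)
      - (r + inverse r) * cycle_resolvent N r k = of_real (shift_ind N k)"
proof -
  define D where "D = (r - inverse r) * (1 - r ^ N)"
  have "r\<^sup>2 \<noteq> 1" "r ^ N \<noteq> 1"
    using power_less_one_iff[of "cmod r"] r N
    by (metis norm_ge_zero norm_one norm_power less_irrefl zero_less_numeral,
        metis norm_ge_zero norm_one norm_power less_irrefl less_le_trans zero_less_numeral)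
  moreover from this have "r - inverse r \<noteq> 0" using r by (auto simp: field_simps power2_eq_square)
  ultimately have D: "D \<noteq> 0" by (simp add: D_def)
  define H where "H m = (r ^ m + r ^ (N - m)) / D" for m
  have H: "cycle_resolvent N r j = H (nat (j mod int N))" for j
    by (simp add: cycle_resolvent_def H_def D_def)
  \<comment> \<open>This lets the successor of residue \<open>N - 1\<close> be written
    \<open>H (Suc m)\<close> although it wraps to 0.\<close>
  have HN: "H N = H 0" by (simp add: H_def)
  define m where "m = nat (k mod int N)"
  have m: "k mod int N = int m" "m < N" using N by (auto simp: m_def nat_less_iff)
  have succ: "cycle_resolvent N r (k + 1) = H (Suc m)"
  proof -
    have "(k + 1) mod int N = (int m + 1) mod int N" by (metis m(1) mod_add_left_eq)
    also have "\<dots> = int (Suc m mod N)" by (simp add: zmod_int add.commute)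
    finally have "nat ((k + 1) mod int N) = (if Suc m = N then 0 else Suc m)"
      using m(2) by auto
    then show ?thesis by (auto simp: H HN)
  qed
  have pred: "cycle_resolvent N r (k - 1) = H (if m = 0 then N - 1 else m - 1)"
  proof -
    have "(k - 1) mod int N = (int m - 1) mod int N" by (metis m(1) mod_diff_left_eq)
    also have "\<dots> = int (if m = 0 then N - 1 else m - 1)"
      using m(2) N by (auto simp: zmod_minus1 of_nat_diff)
    finally show ?thesis by (simp add: H)
  qed
  have cur: "cycle_resolvent N r k = H m" by (simp add: H m_def)
  have ind: "shift_ind N k = (if m = 0 then 1 else 0)"
    using m(1) by (auto simp: shift_ind_def dvd_eq_mod_eq_0)
  show ?thesis
  proof (cases "m = 0")
    case True
    obtain M where M: "N = Suc M" using N by (cases N) auto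
    have "H 1 + H M - (r + inverse r) * H 0 =
        (r + r ^ M + (r ^ M + r) - (r + inverse r) * (1 + r ^ Suc M)) / D"
      by (simp add: H_def M diff_divide_distrib add_divide_distrib algebra_simps)
    also have "r + r ^ M + (r ^ M + r) - (r + inverse r) * (1 + r ^ Suc M) = D"
      using r by (simp add: D_def M field_simps)
    finally show ?thesis using True D succ pred ind cur by (simp add: M)
  next
    case False
    then obtain a where a: "m = Suc a" by (cases m) auto
    \<comment> \<open>With \<open>m = a + 1\<close> and \<open>N - m = b + 1\<close>, all exponents
      are free of truncated subtraction.\<close>
    obtain b where b: "N = Suc (Suc (a + b))"
      using m(2) a less_imp_add_positive[of "Suc a" N] by (metis add_Suc add_Suc_right gr0_conv_Suc)
    have "H (Suc m) + H (m - 1) - (r + inverse r) * H m = 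
        (r ^ Suc (Suc a) + r ^ b + (r ^ a + r ^ Suc (Suc b))
          - (r + inverse r) * (r ^ Suc a + r ^ Suc b)) / D"
      by (simp add: H_def a b diff_divide_distrib add_divide_distrib algebra_simps)
    also have "\<dots> = 0" using r by (simp add: field_simps)
    finally show ?thesis using False succ pred ind cur by simp
  qed
qed

lemma C2_eq_cycle_resolvent:
  assumes "N \<ge> 7"
  shows "C2 N = cycle_resolvent N (rho2 N) 0"
proof -
  \<comment> \<open>A vanishing \<open>d2 N\<close> would turn the quotient in \<open>B2\<close>
    into the default value 0.\<close>
  have "(rho2 N)\<^sup>2 \<noteq> 1"
    using power_less_one_iff[of "cmod (rho2 N)" 2] rho2_properties(3)[OF assms]
    by (metis norm_ge_zero norm_one norm_power less_irrefl zero_less_numeral)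
  then have d: "d2 N \<noteq> 0"
    using rho2_properties(1)[OF assms] by (auto simp: d2_def field_simps power2_eq_square)
  have "P2 N N + d2 N * B2 N N = 2 * rho2 N ^ N"
    using d by (simp add: P2_def B2_def)
  then have "C2 N = (2 * (1 + rho2 N ^ N)) / (2 * (d2 N * (1 - rho2 N ^ N)))"
    by (simp add: C2_def diff_diff_add add.assoc)
  also have "\<dots> = (1 + rho2 N ^ N) / (d2 N * (1 - rho2 N ^ N))"
    by (rule mult_divide_mult_cancel_left) simp
  finally show ?thesis by (simp add: cycle_resolvent_def d2_def)
qed

text \<open>Applying \<open>A - cnj \<tau> = A + \<tau> + 1\<close> to \<open>(A - \<tau>) h = \<delta>\<close> gives \<open>M h = (A + \<tau> + 1) \<delta>\<close>, and the
  right-hand side has imaginary part \<open>Im \<tau> \<delta>\<close>.\<close>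

lemma Im_cycle_resolvent:
  assumes N: "N \<ge> 7"
  defines "h \<equiv> cycle_resolvent N (rho2 N)"
  shows "real (N - 5) * Im (h k) + (\<Sum>e\<in>{-2..2}. Im (h (k + e))) =
    sqrt (4 * real N - 25) / 2 * shift_ind N k"
proof -
  define t where "t = tau2 N"
  define D where "D j = complex_of_real (shift_ind N j)" for j
  have rec: "h (j + 1) + h (j - 1) - t * h j = D j" for j
    using cycle_resolvent_eq[of N "rho2 N" j] rho2_properties[OF N] N
    by (simp add: h_def t_def D_def)
  have q: "t\<^sup>2 + t + of_nat N - 6 = 0" using tau2_quadratic[OF N] by (simp add: t_def)
  have n5: "of_nat (N - 5) = (of_nat N - 5 :: complex)" using N by (simp add: of_nat_diff)
  have e: "{-2..2} = {-2, -1, 0, 1, 2::int}" by auto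
  have "of_nat (N - 5) * h k + (\<Sum>e\<in>{-2..2}. h (k + e)) =
      (of_nat N - 4) * h k + (h (k + 2) + h (k - 2)) + (h (k + 1) + h (k - 1))"
    by (simp add: e n5 algebra_simps)
  \<comment> \<open>The recurrence at \<open>k + 1\<close> and \<open>k - 1\<close> eliminates the
    second neighbours; at \<open>k\<close> it then eliminates the first, leaving the quadratic in
    \<open>t\<close> as coefficient of \<open>h k\<close>.\<close>
  also have "h (k + 2) = t * h (k + 1) + D (k + 1) - h k"
    using rec[of "k + 1"] by (simp add: algebra_simps)
  also have "h (k - 2) = t * h (k - 1) + D (k - 1) - h k"
    using rec[of "k - 1"] by (simp add: algebra_simps)
  also have "t * h (k + 1) + D (k + 1) - h k + (t * h (k - 1) + D (k - 1) - h k) = t * (h (k + 1) + h (k - 1)) + D (k + 1) + D (k - 1) - 2 * h k"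
    by (simp add: algebra_simps)
  also have "h (k + 1) + h (k - 1) = t * h k + D k"
    using rec[of k] by (simp add: algebra_simps)
  also have "(of_nat N - 4) * h k + (t * (t * h k + D k) + D (k + 1) + D (k - 1) - 2 * h k)
      + (t * h k + D k) = (t\<^sup>2 + t + of_nat N - 6) * h k + t * D k + D k + D (k + 1) + D (k - 1)"
    by (simp add: algebra_simps power2_eq_square)
  also have "\<dots> = t * D k + D k + D (k + 1) + D (k - 1)" by (simp add: q)
  finally have "Im (of_nat (N - 5) * h k + (\<Sum>e\<in>{-2..2}. h (k + e))) =
      Im (t * D k + D k + D (k + 1) + D (k - 1))" by simp
  then show ?thesis
    by (simp add: Im_sum D_def t_def tau2_def)
qed

theorem theorem4p6:
  fixes N :: nat
  assumes "N \<ge> 7" and "odd N"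
  shows "kirchhoff_index N (G2_adj N) =
           2 * (real N)\<^sup>2 / sqrt (4 * real N - 25) * Im (C2 N) - 1"
proof -
  note N = \<open>N \<ge> 7\<close>
  define s where "s = sqrt (4 * real N - 25)"
  have s: "s > 0" using N by (simp add: s_def)
  define h where "h = cycle_resolvent N (rho2 N)"
  \<comment> \<open>The factor \<open>2 / s\<close> is the reciprocal of the imaginary part of
    \<open>tau2 N\<close>.\<close>
  define f where "f k = 2 / s * Im (h k)" for k
  define G where "G = mat N N (\<lambda>(x, y). f (int x - int y))"
  have f_per: "f (k + int N) = f k" for k
    by (simp add: f_def h_def cycle_resolvent_periodic)
  have f_even: "f (- k) = f k" for k
    using N by (simp add: f_def h_def cycle_resolvent_uminus)
  have f_inv: "real (N - 5) * f k + (\<Sum>e\<in>{-2..2}. f (k + e)) = shift_ind N k" for k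
  proof -
    have "real (N - 5) * f k + (\<Sum>e\<in>{-2..2}. f (k + e)) =
        2 / s * (real (N - 5) * Im (h k) + (\<Sum>e\<in>{-2..2}. Im (h (k + e))))"
      by (simp add: f_def algebra_simps sum_distrib_left)
    also have "\<dots> = shift_ind N k"
      unfolding h_def Im_cycle_resolvent[OF N] using s by (simp flip: s_def)
    finally show ?thesis .
  qed
  have G: "G \<in> carrier_mat N N" by (simp add: G_def)
  have G_sym: "transpose_mat G = G"
  proof (intro eq_matI)
    fix x y assume "x < dim_row G" "y < dim_col G"
    then show "transpose_mat G $$ (x, y) = G $$ (x, y)"
      using f_even[of "int x - int y"] by (simp add: G_def)
  qed (simp_all add: G_def)
  have "(laplacian_mat N (G2_adj N) + ones_mat N) * G = 1\<^sub>m N"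
  proof (intro eq_matI)
    fix x y assume "x < dim_row (1\<^sub>m N :: real mat)" "y < dim_col (1\<^sub>m N :: real mat)"
    then have xy: "x < N" "y < N" by auto
    then have "shift_ind N (int x - int y) = (if x = y then 1 else 0)"
      by (auto simp: shift_ind_def simp flip: mod_eq_dvd_iff)
    then show "((laplacian_mat N (G2_adj N) + ones_mat N) * G) $$ (x, y) = 1\<^sub>m N $$ (x, y)"
      using laplacian_G2_mult_circulant[of N f, OF N f_per xy] xy by (simp add: G_def f_inv)
  qed (simp_all add: G_def ones_mat_def)
  moreover have "G2_adj N x y \<longleftrightarrow> G2_adj N y x" for x y
    by (auto simp: G2_adj_def circular_distance_def abs_minus_commute)
  ultimately have "kirchhoff_index N (G2_adj N) = real N * (\<Sum>x\<in>{0..<N}. G $$ (x, x)) - 1"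
    using N G G_sym by (intro kirchhoff_index_eq_trace_inverse) auto
  \<comment> \<open>A circulant has constant diagonal, which supplies the second factor
    \<open>N\<close>.\<close>
  also have "(\<Sum>x\<in>{0..<N}. G $$ (x, x)) = real N * f 0"
    by (simp add: G_def)
  also have "f 0 = 2 / s * Im (C2 N)"
    using C2_eq_cycle_resolvent[OF N] by (simp add: f_def h_def)
  finally show ?thesis
    by (simp add: s_def power2_eq_square)
qed

end
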